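(* Let $I$ be an open interval in $\mathbb{R}$. If $f \in S^0(I)$, then the set $$\left\{ x \in I \,\middle|\, f \text{ is discontinuous at } x \text{ and } f^{\mathrm{sd}}(x) \neq 0 \right\}$$ is at most countable.
   Context: For an open interval $I\subset\mathbb{R}$, a function $f:I\to\mathbb{R}$ and a point $x\in I$, the specular derivative of $f$ at $x$ is $$f^{\mathrm{sd}}(x) := \lim_{h \searrow 0} \mathcal{A}(f(x + h) - f(x), f(x) - f(x - h), h)$$ (with $h>0$ small enough that $x\pm h\in I$), where $\mathcal{A}:\mathbb{R}\times\mathbb{R}\times(0,\infty)\to\mathbb{R}$ is $$\mathcal{A}(a, b, c) := \frac{a \sqrt{b^2 + c^2} + b \sqrt{a^2 + c^2}}{c \sqrt{a^2 + c^2} + c \sqrt{b^2 + c^2}}.$$ $f$ is specularly differentiable at $x$ if this limit exists as a finite real number, and specularly differentiable on $I$ if it is so at every point of $I$. $S^0(I)$ is the set of functions $f:I\to\mathbb{R}$ that are specularly differentiable on $I$ (no continuity or measurability is assumed). *)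

theory Defs
  imports "HOL-Analysis.Analysis"
begin

definition spec_A :: "real \<Rightarrow> real \<Rightarrow> real \<Rightarrow> real" where
  "spec_A a b c =
    (a * sqrt (b\<^sup>2 + c\<^sup>2) + b * sqrt (a\<^sup>2 + c\<^sup>2)) /
    (c * sqrt (a\<^sup>2 + c\<^sup>2) + c * sqrt (b\<^sup>2 + c\<^sup>2))"

(* A function on an open interval I is represented by a total function on the reals. The limits
   below are taken along at_right 0, so at a point of an open I they depend only on the values
   of f on I. *)

definition spec_quotient :: "(real \<Rightarrow> real) \<Rightarrow> real \<Rightarrow> real \<Rightarrow> real" where
  "spec_quotient f x h = spec_A (f (x + h) - f x) (f x - f (x - h)) h"

definition specularly_differentiable :: "(real \<Rightarrow> real) \<Rightarrow> real \<Rightarrow> bool" where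
  "specularly_differentiable f x \<longleftrightarrow> (\<exists>l. (spec_quotient f x \<longlongrightarrow> l) (at_right 0))"

(* Lim is a definite description, hence meaningful only where f is specularly differentiable. *)
definition spec_deriv :: "(real \<Rightarrow> real) \<Rightarrow> real \<Rightarrow> real" where
  "spec_deriv f x = Lim (at_right 0) (spec_quotient f x)"

definition spec_S0 :: "real set \<Rightarrow> (real \<Rightarrow> real) set" where
  "spec_S0 I = {f. \<forall>x\<in>I. specularly_differentiable f x}"

end

theory Submission
  imports Defs
begin

text \<open>
  Writing \<open>a = c tan \<alpha>\<close> and \<open>b = c tan \<beta>\<close> turns \<open>spec_A a b c\<close> into
  \<open>tan ((\<alpha> + \<beta>) / 2)\<close>. Hence, if the specular derivative at \<open>x\<close> is positive,
  neither one-sided difference quotient can be very negative for small \<open>h\<close>: an angle close to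
  \<open>-\<pi>/2\<close> cannot be compensated by the other one, which stays below \<open>\<pi>/2\<close>
  (\<open>spec_A_le\<close>). So for some \<open>n\<close> the function \<open>g t = f t + n t\<close> satisfies
  \<open>g y \<le> g x\<close> for \<open>x - 1/n < y < x\<close> and \<open>g x \<le> g y\<close> for \<open>x < y < x + 1/n\<close>
  (\<open>spec_deriv_pos_imp_increasing_point\<close>).

  For a fixed \<open>g\<close> and a fixed radius, only countably many points with this property are
  discontinuities (\<open>countable_discontinuities_increasing_points\<close>). The argument is the one
  for monotone functions, where disjoint jump intervals contain distinct rationals, and it works
  because such points, when close together, are ordered by \<open>g\<close> also relative to all the values
  that \<open>g\<close> takes in between. Adding a linear function does not change the discontinuities, so a
  union over \<open>n\<close> settles the points with positive specular derivative; replacing \<open>f\<close> by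
  \<open>-f\<close> settles the others.
\<close>

section \<open>Points of increase with a uniform radius\<close>

definition increasing_points :: "real \<Rightarrow> (real \<Rightarrow> real) \<Rightarrow> real set" where
  "increasing_points \<delta> g =
    {x. (\<forall>y. x - \<delta> < y \<longrightarrow> y < x \<longrightarrow> g y \<le> g x) \<and> (\<forall>y. x < y \<longrightarrow> y < x + \<delta> \<longrightarrow> g x \<le> g y)}"

text \<open>
  A left discontinuity at a point of increase is a downward jump, so some rational \<open>q < g x\<close>
  exceeds values of \<open>g\<close> arbitrarily close to the left of \<open>x\<close>. A nearby point of increase to the
  left of \<open>x\<close> bounds these values from below and so cannot have the same \<open>q\<close>. A second rational
  records the position of \<open>x\<close> up to \<open>\<delta>/2\<close>, which makes points with equal labels nearby.
\<close>

lemma countable_left_discontinuities_increasing_points: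
  fixes g :: "real \<Rightarrow> real"
  assumes "\<delta> > 0"
  shows "countable {x \<in> increasing_points \<delta> g. \<not> (g \<longlongrightarrow> g x) (at_left x)}" (is "countable ?S")
proof -
  define T where "T = (\<lambda>p q. {x \<in> increasing_points \<delta> g. \<bar>x - p\<bar> < \<delta> / 2 \<and>
    q < g x \<and> (\<exists>\<^sub>F y in at_left x. g y < q)})"
  have not_less: False if x1: "x1 \<in> T p q" and x2: "x2 \<in> T p q" and "x1 < x2" for p q x1 x2
  proof -
    have "\<bar>x1 - p\<bar> < \<delta> / 2" "\<bar>x2 - p\<bar> < \<delta> / 2"
      using x1 x2 unfolding T_def by blast+
    then have "x2 < x1 + \<delta>" by linarith
    then have "q < g y" if "x1 < y" "y < x2" for y
      using x1 that unfolding T_def increasing_points_def by force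
    then have "\<not> g y < q" if "y \<in> {x1<..<x2}" for y
      using that by fastforce
    then have "eventually (\<lambda>y. \<not> g y < q) (at_left x2)"
      by (rule eventually_mono[OF eventually_at_left_real[OF \<open>x1 < x2\<close>]])
    then show False
      using x2 unfolding T_def by (auto simp: frequently_def)
  qed
  have "countable (T p q)" for p q
  proof (cases "T p q = {}")
    case False
    then obtain x where "x \<in> T p q" by blast
    then have "T p q \<subseteq> {x}"
      using not_less by (metis linorder_neqE_linordered_idom singletonI subsetI)
    then show ?thesis
      by (rule countable_subset) simp
  qed simp
  moreover have "?S \<subseteq> (\<Union>p\<in>\<rat>. \<Union>q\<in>\<rat>. T p q)"
  proof
    fix x assume "x \<in> ?S"
    then have x: "x \<in> increasing_points \<delta> g" and disc: "\<not> (g \<longlongrightarrow> g x) (at_left x)" by auto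
    have below: "eventually (\<lambda>y. g y \<le> g x) (at_left x)"
      using eventually_at_left_real[of "x - \<delta>" x] x assms
      by (auto simp: increasing_points_def elim!: eventually_mono)
    have "\<exists>l<g x. \<not> eventually (\<lambda>y. l < g y) (at_left x)"
    proof (rule ccontr)
      assume "\<not> ?thesis"
      then have "(g \<longlongrightarrow> g x) (at_left x)"
        using below by (intro order_tendstoI) (auto elim!: eventually_mono)
      with disc show False ..
    qed
    then obtain l where "l < g x" and l: "\<exists>\<^sub>F y in at_left x. g y \<le> l"
      by (auto simp: frequently_def not_le)
    obtain q where q: "q \<in> \<rat>" "l < q" "q < g x"
      using Rats_dense_in_real[OF \<open>l < g x\<close>] by blast
    have freq: "\<exists>\<^sub>F y in at_left x. g y < q"
      using l by (rule frequently_elim1) (use q in auto)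
    obtain p where p: "p \<in> \<rat>" "x - \<delta> / 2 < p" "p < x"
      using Rats_dense_in_real[of "x - \<delta> / 2" x] assms by auto
    then have "\<bar>x - p\<bar> < \<delta> / 2" by auto
    then show "x \<in> (\<Union>p\<in>\<rat>. \<Union>q\<in>\<rat>. T p q)"
      using x p q freq unfolding T_def by blast
  qed
  ultimately show ?thesis
    by (meson countable_UN countable_rat countable_subset)
qed

lemma countable_discontinuities_increasing_points:
  fixes g :: "real \<Rightarrow> real"
  assumes "\<delta> > 0"
  shows "countable {x \<in> increasing_points \<delta> g. \<not> isCont g x}"
proof -
  define r where "r = (\<lambda>t. - g (- t))"
  let ?L = "\<lambda>g. {x \<in> increasing_points \<delta> g. \<not> (g \<longlongrightarrow> g x) (at_left x)}"
  \<comment> \<open>The half-turn about the origin preserves points of increase and exchanges left and right.\<close>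
  have reflect: "- x \<in> ?L r"
    if x: "x \<in> increasing_points \<delta> g" and disc: "\<not> (g \<longlongrightarrow> g x) (at_right x)" for x
  proof -
    have "g (- y) \<ge> g x" if "- x - \<delta> < y" "y < - x" for y
      using x that unfolding increasing_points_def by auto
    moreover have "g (- y) \<le> g x" if "- x < y" "y < - x + \<delta>" for y
      using x that unfolding increasing_points_def by auto
    ultimately have "- x \<in> increasing_points \<delta> r"
      unfolding increasing_points_def r_def by auto
    moreover have "\<not> (r \<longlongrightarrow> r (- x)) (at_left (- x))"
    proof
      assume "(r \<longlongrightarrow> r (- x)) (at_left (- x))"
      then have "((\<lambda>t. - r (- t)) \<longlongrightarrow> - r (- x)) (at_right x)"
        by (intro tendsto_minus) (simp add: at_left_minus filterlim_filtermap)
      with disc show False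
        by (simp add: r_def)
    qed
    ultimately show ?thesis by simp
  qed
  have "{x \<in> increasing_points \<delta> g. \<not> isCont g x} \<subseteq> ?L g \<union> uminus ` ?L r"
  proof
    fix x assume "x \<in> {x \<in> increasing_points \<delta> g. \<not> isCont g x}"
    then have x: "x \<in> increasing_points \<delta> g"
      and "\<not> (g \<longlongrightarrow> g x) (at_left x) \<or> \<not> (g \<longlongrightarrow> g x) (at_right x)"
      by (auto simp: isCont_def filterlim_at_split)
    then show "x \<in> ?L g \<union> uminus ` ?L r"
      using reflect[OF x] by (force intro: image_eqI[of _ _ "- x"])
  qed
  then show ?thesis
    by (rule countable_subset)
      (intro countable_Un countable_image
        countable_left_discontinuities_increasing_points[OF assms])
qed

section \<open>Specular quotients\<close>

lemma spec_A_commute: "spec_A a b c = spec_A b a c"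
  by (simp add: spec_A_def add.commute)

lemma spec_A_minus: "spec_A (- a) (- b) c = - spec_A a b c"
proof -
  have "- a * s + - b * t = - (a * s + b * t)" for s t by simp
  then show ?thesis
    unfolding spec_A_def power2_minus by (simp only: minus_divide_left)
qed

text \<open>
  For \<open>b \<le> 0\<close> the left-hand side is not positive. For \<open>b > 0\<close> the two summands of
  the numerator nearly cancel: the gain of
  \<open>sqrt (a\<^sup>2 + c\<^sup>2)\<close> over \<open>\<bar>a\<bar>\<close> is at most \<open>c / m\<close>, so the numerator
  is at most \<open>c / m * sqrt (b\<^sup>2 + c\<^sup>2)\<close>, which is \<open>1 / m\<close> times a part of the denominator.
\<close>

lemma spec_A_le:
  assumes c: "c > 0" and m: "m > 0" and a: "a \<le> - m * c"
  shows "spec_A a b c \<le> 1 / m"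
proof -
  define s where "s = sqrt (a\<^sup>2 + c\<^sup>2)"
  define t where "t = sqrt (b\<^sup>2 + c\<^sup>2)"
  have s: "s > 0" and t: "t > 0" and tb: "\<bar>b\<bar> \<le> t"
    using c unfolding s_def t_def by (auto intro!: real_le_rsqrt add_nonneg_pos)
  have "m * c \<le> - a" using a by simp
  then have "c / m * (m * c) \<le> c / m * (- a)"
    using c m by (intro mult_left_mono) auto
  then have "c\<^sup>2 \<le> c / m * (- a)"
    using m by (simp add: power2_eq_square)
  then have "a\<^sup>2 + c\<^sup>2 \<le> a\<^sup>2 + 2 * (c / m * (- a)) + (c / m)\<^sup>2"
    using zero_le_power2[of "c / m"] zero_le_power2[of c] by linarith
  then have "a\<^sup>2 + c\<^sup>2 \<le> (- a + c / m)\<^sup>2"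
    by (simp only: power2_sum) (simp add: algebra_simps)
  moreover have "a < 0"
    using a mult_pos_pos[OF m c] by simp
  moreover have "0 < c / m" using c m by simp
  ultimately have s_le: "s \<le> - a + c / m"
    unfolding s_def by (intro real_le_lsqrt) auto
  have "a * t + b * s \<le> t * (c / m)"
  proof (cases "b \<ge> 0")
    case True
    have "b * s \<le> t * s"
      using tb s by (intro mult_right_mono) auto
    also have "\<dots> \<le> t * (- a + c / m)"
      using s_le t by (intro mult_left_mono) auto
    finally show ?thesis by (simp add: algebra_simps)
  next
    case False
    have "b * s \<le> 0" "a * t \<le> 0" "0 \<le> t * (c / m)"
      using False s t c m \<open>a < 0\<close> by (auto simp: mult_le_0_iff)
    then show ?thesis by linarith
  qed
  also have "\<dots> \<le> 1 / m * (c * s + c * t)"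
    using s c m by (simp add: field_simps)
  finally have "(a * t + b * s) / (c * s + c * t) \<le> 1 / m"
    using s t c by (subst pos_divide_le_eq) (auto simp: add_pos_pos)
  then show ?thesis
    by (simp add: spec_A_def s_def t_def)
qed

lemma spec_quotient_tendsto_spec_deriv:
  assumes "specularly_differentiable f x"
  shows "(spec_quotient f x \<longlongrightarrow> spec_deriv f x) (at_right 0)"
  using assms unfolding specularly_differentiable_def spec_deriv_def
  by (metis tendsto_Lim trivial_limit_at_right_real)

lemma spec_quotient_uminus: "spec_quotient (\<lambda>t. - f t) x h = - spec_quotient f x h"
  using spec_A_minus[of "f (x + h) - f x" "f x - f (x - h)" h]
  by (simp add: spec_quotient_def)

lemma
  assumes "specularly_differentiable f x"
  shows specularly_differentiable_uminus: "specularly_differentiable (\<lambda>t. - f t) x"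
    and spec_deriv_uminus: "spec_deriv (\<lambda>t. - f t) x = - spec_deriv f x"
proof -
  have lim: "(spec_quotient (\<lambda>t. - f t) x \<longlongrightarrow> - spec_deriv f x) (at_right 0)"
    unfolding spec_quotient_uminus
    by (intro tendsto_minus spec_quotient_tendsto_spec_deriv assms)
  then show "specularly_differentiable (\<lambda>t. - f t) x"
    unfolding specularly_differentiable_def by blast
  show "spec_deriv (\<lambda>t. - f t) x = - spec_deriv f x"
    unfolding spec_deriv_def using tendsto_Lim[OF trivial_limit_at_right_real lim]
    by (simp add: spec_deriv_def)
qed

section \<open>Countability of the discontinuities\<close>

text \<open>
  A single natural number \<open>n\<close> serves as slope and as inverse radius, so that countably many
  functions and radii suffice. For this,
  \<open>1 / n\<close> has to be at most a positive lower bound of the specular quotients and at most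
  the radius on which that bound holds.
\<close>

lemma spec_deriv_pos_imp_increasing_point:
  assumes diff: "specularly_differentiable f x" and pos: "spec_deriv f x > 0"
  shows "\<exists>n::nat. x \<in> increasing_points (1 / Suc n) (\<lambda>t. f t + Suc n * t)"
proof -
  obtain k :: nat where k: "1 / Suc k < spec_deriv f x"
    using reals_Archimedean[OF pos] by (auto simp: inverse_eq_divide)
  have "eventually (\<lambda>h. 1 / Suc k < spec_quotient f x h) (at_right 0)"
    by (rule order_tendstoD(1)[OF spec_quotient_tendsto_spec_deriv[OF diff] k])
  then obtain d where "d > 0" and d: "\<And>h. 0 < h \<Longrightarrow> h < d \<Longrightarrow> 1 / Suc k < spec_quotient f x h"
    by (auto simp: eventually_at_right_field)
  obtain j :: nat where j: "1 / Suc j < d"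
    using reals_Archimedean[OF \<open>d > 0\<close>] by (auto simp: inverse_eq_divide)
  define n where "n = max k j"
  have nk: "1 / real (Suc n) \<le> 1 / Suc k" and nj: "1 / real (Suc n) \<le> 1 / Suc j"
    unfolding n_def by (auto intro!: divide_left_mono)
  have slopes: "- real (Suc n) * h < f (x + h) - f x" "- real (Suc n) * h < f x - f (x - h)"
    if h: "0 < h" "h < 1 / Suc n" for h
  proof -
    have "1 / Suc n < spec_A (f (x + h) - f x) (f x - f (x - h)) h"
      using d[of h] h nk nj j by (simp add: spec_quotient_def)
    then show "- real (Suc n) * h < f (x + h) - f x" "- real (Suc n) * h < f x - f (x - h)"
      using spec_A_le[of h "Suc n" "f (x + h) - f x" "f x - f (x - h)"]
        spec_A_le[of h "Suc n" "f x - f (x - h)" "f (x + h) - f x"] h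
        spec_A_commute[of "f (x + h) - f x" "f x - f (x - h)" h]
      by (auto simp: not_le[symmetric])
  qed
  have "f y + Suc n * y \<le> f x + Suc n * x" if "x - 1 / Suc n < y" "y < x" for y :: real
    using slopes(2)[of "x - y"] that by (simp add: algebra_simps)
  moreover have "f x + Suc n * x \<le> f y + Suc n * y" if "x < y" "y < x + 1 / Suc n" for y :: real
    using slopes(1)[of "y - x"] that by (simp add: algebra_simps)
  ultimately show ?thesis
    unfolding increasing_points_def by blast
qed

lemma countable_discontinuities_spec_deriv_pos:
  "countable {x. specularly_differentiable f x \<and> \<not> isCont f x \<and> spec_deriv f x > 0}"
proof (rule countable_subset)
  let ?g = "\<lambda>(n::nat) t. f t + real (Suc n) * t"
  show "countable (\<Union>n. {x \<in> increasing_points (1 / real (Suc n)) (?g n). \<not> isCont (?g n) x})"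
    by (intro countable_UN countable_discontinuities_increasing_points) auto
  have cont: "isCont f x" if "isCont (?g n) x" for n x
    using isCont_diff[OF that, of "\<lambda>t. real (Suc n) * t"] by simp
  show "{x. specularly_differentiable f x \<and> \<not> isCont f x \<and> spec_deriv f x > 0}
      \<subseteq> (\<Union>n. {x \<in> increasing_points (1 / real (Suc n)) (?g n). \<not> isCont (?g n) x})"
  proof
    fix x
    assume x: "x \<in> {x. specularly_differentiable f x \<and> \<not> isCont f x \<and> spec_deriv f x > 0}"
    then obtain n where "x \<in> increasing_points (1 / real (Suc n)) (?g n)"
      using spec_deriv_pos_imp_increasing_point[of f x] by auto
    moreover have "\<not> isCont (?g n) x"
      using x cont by blast
    ultimately have "x \<in> {x \<in> increasing_points (1 / real (Suc n)) (?g n). \<not> isCont (?g n) x}"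
      by simp
    then show "x \<in> (\<Union>n. {x \<in> increasing_points (1 / real (Suc n)) (?g n). \<not> isCont (?g n) x})"
      by (rule UN_I[OF UNIV_I])
  qed
qed

theorem theorem4p1:
  fixes I :: "real set" and f :: "real \<Rightarrow> real"
  assumes "open I" and "is_interval I"
    and "f \<in> spec_S0 I"
  shows "countable {x \<in> I. \<not> continuous (at x within I) f \<and> spec_deriv f x \<noteq> 0}"
proof (rule countable_subset)
  let ?P = "\<lambda>f. {x. specularly_differentiable f x \<and> \<not> isCont f x \<and> spec_deriv f x > 0}"
  show "countable (?P f \<union> ?P (\<lambda>t. - f t))"
    by (intro countable_Un countable_discontinuities_spec_deriv_pos)
  show "{x \<in> I. \<not> continuous (at x within I) f \<and> spec_deriv f x \<noteq> 0} \<subseteq> ?P f \<union> ?P (\<lambda>t. - f t)"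
  proof
    fix x assume x: "x \<in> {x \<in> I. \<not> continuous (at x within I) f \<and> spec_deriv f x \<noteq> 0}"
    then have diff: "specularly_differentiable f x"
      using assms(3) by (auto simp: spec_S0_def)
    have disc: "\<not> isCont f x"
      using x at_within_open[OF _ assms(1), of x] by simp
    then have "\<not> isCont (\<lambda>t. - f t) x"
      using isCont_minus[of x "\<lambda>t. - f t"] by fastforce
    moreover have "spec_deriv f x > 0 \<or> spec_deriv f x < 0"
      using x by auto
    ultimately show "x \<in> ?P f \<union> ?P (\<lambda>t. - f t)"
      using diff disc specularly_differentiable_uminus[OF diff] spec_deriv_uminus[OF diff] by auto
  qed
qed

end
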